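(* Let $\mathcal{Z}$ be a finite state space with $|\mathcal{Z}|=N\ge 2$, let $\mathcal{T}$ be a non-empty, compact and convex set of transition matrices on $\mathcal{Z}$ with separately specified rows, and let $A\subset\mathcal{Z}$ be a closed target set. Let $A^c=\mathcal{Z}\setminus A$, let $\mathscr{A}_{\mathcal{T}}$ be the set of all $z\in A^c$ from which $A$ is not lower reachable, let $\mathscr{U}_{\mathcal{T}}$ be the set of all $z\in A^c\setminus\mathscr{A}_{\mathcal{T}}$ from which $\mathscr{A}_{\mathcal{T}}$ is upper reachable, and let $\mathscr{B}_{\mathcal{T}}:=\mathscr{A}_{\mathcal{T}}\cup\mathscr{U}_{\mathcal{T}}$. Then $\overline{h}^{\mathcal{T}}_A(z)=+\infty$ for all $z\in\mathscr{B}_{\mathcal{T}}$. Moreover, there exists a matrix $\tilde{T}\in\mathcal{T}$ such that $$\overline{h}^{\mathcal{T}}_A\big|_{A^c\setminus\mathscr{B}_{\mathcal{T}}}=\bigl(I-\tilde{T}|_{A^c\setminus\mathscr{B}_{\mathcal{T}}}\bigr)^{-1}\mathbf{1},$$ where $I$ is the identity matrix and $\mathbf{1}$ is the vector of all ones (in particular, the inverse exists).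
   Context: A transition matrix on $\mathcal{Z}$ is a row-stochastic matrix $T=(T(z,z'))_{z,z'\in\mathcal{Z}}$; it acts on $f\in\mathbb{R}^{N}$ (functions $\mathcal{Z}\to\mathbb{R}$) by $[Tf](z)=\sum_{z'}T(z,z')f(z')$. $\mathcal{T}$ has separately specified rows if there are sets $\mathcal{T}_z$ ($z\in\mathcal{Z}$) of probability mass functions on $\mathcal{Z}$ such that $\mathcal{T}$ consists of exactly the transition matrices $T$ with $T(z,\cdot)\in\mathcal{T}_z$ for all $z$. Upper and lower transition operators: $[\overline{T}f](z):=\sup_{T\in\mathcal{T}}[Tf](z)$ and $[\underline{T}f](z):=\inf_{T\in\mathcal{T}}[Tf](z)$ for $f\in\mathbb{R}^N$, $z\in\mathcal{Z}$. Write $\mathbb{1}_{C}$ for the indicator of $C\subseteq\mathcal{Z}$. $C$ is upper reachable from $z$ if there is $n\in\mathbb{N}=\{1,2,\dots\}$ with $[\overline{T}^n\mathbb{1}_{C}](z)>0$, and lower reachable from $z$ if there is $n\in\mathbb{N}$ with $[\underline{T}^n\mathbb{1}_{C}](z)>0$. The set $A$ is closed if $T(x,y)=0$ for all $x\in A$, $y\notin A$ and all $T\in\mathcal{T}$. Hitting time: for a stochastic process $(Z_n)_{n\ge 0}$ on $\mathcal{Z}$, $\tau_A:=\inf\{n\ge 0: Z_n\in A\}\in\{0,1,2,\dots\}\cup\{+\infty\}$. The upper expected hitting time is $\overline{h}^{\mathcal{T}}_A(z):=\sup_{T\in\mathcal{T}}\mathbb{E}_{T}[\tau_A\mid Z_0=z]\in[0,+\infty]$,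 where $\mathbb{E}_T$ is expectation for the homogeneous Markov chain with transition matrix $T$. For $B\subseteq\mathcal{Z}$, $T|_{B}=(T(i,j))_{i,j\in B}$ is the submatrix of $T$ indexed by $B$, and $h|_B$ is the restriction of a vector $h$ to $B$. *)

theory Defs
  imports "HOL-Probability.Probability"
begin

section \<open>Sets of transition matrices\<close>

text \<open>The state space is the finite type \<open>'n\<close>; \<open>T $ z $ z'\<close> is the probability of moving from
  \<open>z\<close> to \<open>z'\<close>, and \<open>T *v f\<close> is the action of \<open>T\<close> on a function \<open>f\<close>.\<close>

definition prob_mass_function :: "real ^ 'n::finite \<Rightarrow> bool" where
  "prob_mass_function p \<longleftrightarrow> (\<forall>z. p $ z \<ge> 0) \<and> (\<Sum>z\<in>UNIV. p $ z) = 1"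

definition transition_matrix :: "real ^ 'n::finite ^ 'n \<Rightarrow> bool" where
  "transition_matrix T \<longleftrightarrow> (\<forall>z. prob_mass_function (T $ z))"

definition separately_specified_rows :: "(real ^ 'n::finite ^ 'n) set \<Rightarrow> bool" where
  "separately_specified_rows \<T> \<longleftrightarrow>
     (\<exists>R :: 'n \<Rightarrow> (real ^ 'n) set.
        (\<forall>z. \<forall>p\<in>R z. prob_mass_function p) \<and>
        \<T> = {T. transition_matrix T \<and> (\<forall>z. T $ z \<in> R z)})"

definition upper_transition :: "(real ^ 'n::finite ^ 'n) set \<Rightarrow> real ^ 'n \<Rightarrow> real ^ 'n" where
  "upper_transition \<T> f = (\<chi> z. SUP T\<in>\<T>. (T *v f) $ z)"

definition lower_transition :: "(real ^ 'n::finite ^ 'n) set \<Rightarrow> real ^ 'n \<Rightarrow> real ^ 'n" where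
  "lower_transition \<T> f = (\<chi> z. INF T\<in>\<T>. (T *v f) $ z)"

definition indicator_vec :: "'n set \<Rightarrow> real ^ 'n::finite" where
  "indicator_vec C = (\<chi> z. indicator C z)"

definition upper_reachable :: "(real ^ 'n::finite ^ 'n) set \<Rightarrow> 'n set \<Rightarrow> 'n \<Rightarrow> bool" where
  "upper_reachable \<T> C z \<longleftrightarrow> (\<exists>n\<ge>1. ((upper_transition \<T> ^^ n) (indicator_vec C)) $ z > 0)"

definition lower_reachable :: "(real ^ 'n::finite ^ 'n) set \<Rightarrow> 'n set \<Rightarrow> 'n \<Rightarrow> bool" where
  "lower_reachable \<T> C z \<longleftrightarrow> (\<exists>n\<ge>1. ((lower_transition \<T> ^^ n) (indicator_vec C)) $ z > 0)"

definition closed_states :: "(real ^ 'n::finite ^ 'n) set \<Rightarrow> 'n set \<Rightarrow> bool" where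
  "closed_states \<T> A \<longleftrightarrow> (\<forall>x\<in>A. \<forall>y. y \<notin> A \<longrightarrow> (\<forall>T\<in>\<T>. T $ x $ y = 0))"

definition avoiding_states :: "(real ^ 'n::finite ^ 'n) set \<Rightarrow> 'n set \<Rightarrow> 'n set" where
  "avoiding_states \<T> A = {z. z \<notin> A \<and> \<not> lower_reachable \<T> A z}"

definition unsafe_states :: "(real ^ 'n::finite ^ 'n) set \<Rightarrow> 'n set \<Rightarrow> 'n set" where
  "unsafe_states \<T> A =
     {z. z \<notin> A \<and> z \<notin> avoiding_states \<T> A \<and> upper_reachable \<T> (avoiding_states \<T> A) z}"

definition bad_states :: "(real ^ 'n::finite ^ 'n) set \<Rightarrow> 'n set \<Rightarrow> 'n set" where
  "bad_states \<T> A = avoiding_states \<T> A \<union> unsafe_states \<T> A"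


section \<open>Homogeneous Markov chains and hitting times\<close>

text \<open>The step kernels: \<open>Z\<^sub>0 = z\<close>, and \<open>Z\<^bsub>n+1\<^esub>\<close> is drawn from row \<open>Z\<^sub>n\<close> of \<open>T\<close>.\<close>

primrec chain_kernel ::
    "real ^ 'n::finite ^ 'n \<Rightarrow> 'n \<Rightarrow> nat \<Rightarrow> (nat \<Rightarrow> 'n) \<Rightarrow> 'n measure" where
  "chain_kernel T z 0 \<omega> = return (count_space UNIV) z"
| "chain_kernel T z (Suc n) \<omega> = point_measure UNIV (\<lambda>y. ennreal (T $ (\<omega> n) $ y))"

text \<open>The law of the chain on trajectories, as the measure provided by the Ionescu-Tulcea theorem.
  It is only meaningful if \<open>T\<close> is a transition matrix; see the two lemmas below.\<close>

definition markov_chain :: "real ^ 'n::finite ^ 'n \<Rightarrow> 'n \<Rightarrow> (nat \<Rightarrow> 'n) measure" where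
  "markov_chain T z =
     projective_family.lim UNIV
       (Ionescu_Tulcea.CI (chain_kernel T z) (\<lambda>_. count_space UNIV)) (\<lambda>_. count_space UNIV)"

lemma Ionescu_Tulcea_chain_kernel:
  fixes T :: "real ^ 'n::finite ^ 'n"
  assumes "transition_matrix T"
  shows "Ionescu_Tulcea (chain_kernel T z) (\<lambda>_. count_space UNIV)"
proof (rule Ionescu_Tulcea.intro)
  have prob: "prob_space (point_measure UNIV (\<lambda>y. ennreal (T $ x $ y)))" for x
    using assms
    by (intro prob_spaceI)
       (simp add: emeasure_point_measure_finite space_point_measure sum_ennreal
          transition_matrix_def prob_mass_function_def)
  show "prob_space (chain_kernel T z i x)" for i x
    by (cases i) (auto intro!: prob_space_return prob)
  have [measurable]: "(\<lambda>x. point_measure UNIV (\<lambda>y. ennreal (T $ x $ y)))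
      \<in> measurable (count_space UNIV) (subprob_algebra (count_space UNIV))"
    by (auto simp: space_subprob_algebra sets_point_measure prob
          intro!: prob_space_imp_subprob_space)
  show "chain_kernel T z i \<in> measurable (PiM {0..<i} (\<lambda>_. count_space UNIV))
      (subprob_algebra (count_space UNIV))" for i
  proof (cases i)
    case 0
    have "chain_kernel T z 0 = (\<lambda>\<omega>. return (count_space UNIV) z)"
      by (simp add: fun_eq_iff)
    with 0 show ?thesis
      by (auto simp: space_subprob_algebra
            intro!: prob_space_imp_subprob_space prob_space_return)
  next
    case (Suc n)
    have "(\<lambda>\<omega>. \<omega> n) \<in> measurable (PiM {0..<Suc n} (\<lambda>_. count_space UNIV)) (count_space UNIV)"
      by (rule measurable_component_singleton) simp
    moreover have "chain_kernel T z (Suc n) =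
        (\<lambda>\<omega>. point_measure UNIV (\<lambda>y. ennreal (T $ (\<omega> n) $ y)))"
      by (simp add: fun_eq_iff)
    ultimately show ?thesis using Suc by simp
  qed
qed

lemma emeasure_markov_chain_path:
  fixes T :: "real ^ 'n::finite ^ 'n"
  assumes T: "transition_matrix T"
  shows "emeasure (markov_chain T z) {\<omega>. \<forall>i\<le>n. \<omega> i = x i} =
    (if x 0 = z then (\<Prod>i<n. ennreal (T $ (x i) $ (x (Suc i)))) else 0)"
proof -
  interpret IT: Ionescu_Tulcea "chain_kernel T z" "\<lambda>_. count_space UNIV"
    by (rule Ionescu_Tulcea_chain_kernel[OF T])
  let ?X = "\<lambda>n. PiE {0..<n} (\<lambda>i. {x i})"
  let ?M = "\<lambda>n. PiM {0..<n} (\<lambda>_::nat. count_space (UNIV :: 'n set))"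
  have X[measurable]: "?X n \<in> sets (?M n)" for n
    by (intro sets_PiM_I_finite) auto
  have X_eq: "?X n = {restrict x {0..<n}}" for n
    by (auto simp: PiE_iff fun_eq_iff extensional_def)
  have C: "emeasure (IT.C 0 (Suc n) (\<lambda>_. undefined)) (?X (Suc n)) =
      emeasure (IT.C 0 n (\<lambda>_. undefined)) (?X n) *
      emeasure (chain_kernel T z n (restrict x {0..<n})) {x n}" for n
  proof -
    have "emeasure (IT.C 0 (Suc n) (\<lambda>_. undefined)) (?X (Suc n)) =
      (\<integral>\<^sup>+\<omega>. emeasure (IT.eP n \<omega>) (?X (Suc n)) \<partial>IT.C 0 n (\<lambda>_. undefined))"
      using IT.measurable_C[of 0 n]
      by (subst IT.C.simps, subst emeasure_bind[where N = "?M (Suc n)"])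
         (auto simp: IT.space_C measurable_cong_sets[OF IT.sets_C])
    also have "\<dots> = (\<integral>\<^sup>+\<omega>. emeasure (chain_kernel T z n (restrict x {0..<n})) {x n} *
        indicator (?X n) \<omega> \<partial>IT.C 0 n (\<lambda>_. undefined))"
    proof (rule nn_integral_cong)
      fix \<omega> assume "\<omega> \<in> space (IT.C 0 n (\<lambda>_. undefined))"
      then have \<omega>: "\<omega> \<in> space (?M n)"
        by (simp add: IT.space_C)
      have "(fun_upd \<omega> n) -` ?X (Suc n) \<inter> space (count_space UNIV) =
          (if \<omega> \<in> ?X n then {x n} else {})"
        using \<omega> by (auto simp: PiE_iff space_PiM extensional_def less_Suc_eq split: if_splits)
      then show "emeasure (IT.eP n \<omega>) (?X (Suc n)) =
          emeasure (chain_kernel T z n (restrict x {0..<n})) {x n} * indicator (?X n) \<omega>"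
        unfolding IT.emeasure_eP[OF \<omega> X] by (auto simp: X_eq split: split_indicator)
    qed
    also have "\<dots> = emeasure (IT.C 0 n (\<lambda>_. undefined)) (?X n) *
        emeasure (chain_kernel T z n (restrict x {0..<n})) {x n}"
      by (subst nn_integral_cmult_indicator) (auto simp: IT.sets_C mult.commute)
    finally show ?thesis .
  qed
  have "emeasure (IT.C 0 (Suc n) (\<lambda>_. undefined)) (?X (Suc n)) =
    (if x 0 = z then (\<Prod>i<n. ennreal (T $ (x i) $ (x (Suc i)))) else 0)" for n
  proof (induction n)
    case 0
    show ?case
      by (subst C) (auto simp: PiE_iff PiM_empty indicator_def)
  next
    case (Suc n)
    then show ?case
      by (subst C) (auto simp: emeasure_point_measure_finite simp del: IT.C.simps)
  qed
  moreover have "{\<omega>. \<forall>i\<le>n. \<omega> i = x i} = IT.PF.emb UNIV {0..<Suc n} (?X (Suc n))"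
    by (auto simp: prod_emb_def PiE_iff space_PiM less_Suc_eq_le)
  ultimately show ?thesis
    unfolding markov_chain_def
    by (simp add: IT.lim IT.emeasure_CI[of _ "Suc n"] del: IT.C.simps)
qed

definition hitting_time :: "'n set \<Rightarrow> (nat \<Rightarrow> 'n) \<Rightarrow> enat" where
  "hitting_time A \<omega> = Inf (enat ` {n. \<omega> n \<in> A})"

definition expected_hitting_time :: "real ^ 'n::finite ^ 'n \<Rightarrow> 'n set \<Rightarrow> 'n \<Rightarrow> ennreal" where
  "expected_hitting_time T A z = (\<integral>\<^sup>+\<omega>. ennreal_of_enat (hitting_time A \<omega>) \<partial>markov_chain T z)"

definition upper_expected_hitting_time ::
    "(real ^ 'n::finite ^ 'n) set \<Rightarrow> 'n set \<Rightarrow> 'n \<Rightarrow> ennreal" where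
  "upper_expected_hitting_time \<T> A z = (SUP T\<in>\<T>. expected_hitting_time T A z)"


section \<open>Submatrices\<close>

text \<open>Index sets of submatrices vary over sets of states, so a matrix indexed by \<open>B\<close> is represented
  by a full matrix of which only the entries in \<open>B \<times> B\<close> matter. The definitions follow
  \<^const>\<open>invertible\<close> and \<^const>\<open>matrix_inv\<close>; the entries of \<open>matrix_inv_on B M\<close> in \<open>B \<times> B\<close>
  are unique if \<open>M\<close> is invertible on \<open>B\<close>.\<close>

definition inverse_on :: "'n set \<Rightarrow> real ^ 'n::finite ^ 'n \<Rightarrow> real ^ 'n ^ 'n \<Rightarrow> bool" where
  "inverse_on B M M' \<longleftrightarrow>
     (\<forall>i\<in>B. \<forall>j\<in>B. (\<Sum>k\<in>B. M $ i $ k * M' $ k $ j) = (if i = j then 1 else 0)) \<and>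
     (\<forall>i\<in>B. \<forall>j\<in>B. (\<Sum>k\<in>B. M' $ i $ k * M $ k $ j) = (if i = j then 1 else 0))"

definition invertible_on :: "'n set \<Rightarrow> real ^ 'n::finite ^ 'n \<Rightarrow> bool" where
  "invertible_on B M \<longleftrightarrow> (\<exists>M'. inverse_on B M M')"

definition matrix_inv_on :: "'n set \<Rightarrow> real ^ 'n::finite ^ 'n \<Rightarrow> real ^ 'n ^ 'n" where
  "matrix_inv_on B M = (SOME M'. inverse_on B M M')"

definition mult_vec_on :: "'n set \<Rightarrow> real ^ 'n::finite ^ 'n \<Rightarrow> real ^ 'n \<Rightarrow> real ^ 'n" where
  "mult_vec_on B M v = (\<chi> i. \<Sum>j\<in>B. M $ i $ j * v $ j)"

end

theory Submission
  imports Defs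
begin

text \<open>The expected hitting time of \<open>A\<close> is the sum over \<open>n\<close> of the probability of not having hit \<open>A\<close>
  up to time \<open>n\<close>. From the states that are not bad, no \<open>T \<in> \<T>\<close> leads to bad ones, and iterating the
  lower transition operator on the indicator of \<open>A\<close> yields a function \<open>g \<ge> 1 + T g\<close> valid for all
  \<open>T \<in> \<T>\<close>; so all hitting times are bounded by \<open>g\<close> there. Let \<open>H\<close> be their supremum and let the rows of
  \<open>T\<close> maximise \<open>T H\<close>. Then \<open>H \<le> 1 + T H\<close>, so the difference of \<open>H\<close> and the hitting time of \<open>T\<close> is
  subharmonic for \<open>T\<close>, and transience forces it to be nonpositive. The same argument shows that
  \<open>I - T\<close> is injective on the good states.\<close>

section \<open>Survival probabilities\<close>

text \<open>The probability that the chain from \<open>z\<close> stays outside \<open>A\<close> at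
  all times up to and including \<open>n\<close>, computed by conditioning on the first step. Once
  the tail-sum formula is available, this real-valued recursion stands in for the path
  measure.\<close>

primrec survival :: "'n set \<Rightarrow> real ^ 'n::finite ^ 'n \<Rightarrow> nat \<Rightarrow> 'n \<Rightarrow> real" where
  "survival A T 0 z = indicator (- A) z"
| "survival A T (Suc n) z = indicator (- A) z * (\<Sum>y\<in>UNIV. T $ z $ y * survival A T n y)"

lemma transition_matrix_nonneg: "transition_matrix T \<Longrightarrow> 0 \<le> T $ x $ y"
  by (simp add: transition_matrix_def prob_mass_function_def)

lemma transition_matrix_row_sum: "transition_matrix T \<Longrightarrow> (\<Sum>y\<in>UNIV. T $ x $ y) = 1"
  by (simp add: transition_matrix_def prob_mass_function_def)

lemma survival_nonneg: "transition_matrix T \<Longrightarrow> 0 \<le> survival A T n z"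
  by (induction n arbitrary: z) (auto intro!: mult_nonneg_nonneg sum_nonneg transition_matrix_nonneg)

lemma survival_target: "z \<in> A \<Longrightarrow> survival A T n z = 0"
  by (cases n) auto

lemma sum_paths_Suc:
  fixes f :: "(nat \<Rightarrow> 'a) \<Rightarrow> 'b::comm_monoid_add"
  shows "(\<Sum>x\<in>PiE {..Suc n} (\<lambda>_. C). f x) =
    (\<Sum>x\<in>PiE {..n} (\<lambda>_. C). \<Sum>y\<in>C. f (x(Suc n := y)))"
proof -
  have inj: "inj_on (\<lambda>(y, g). g(Suc n := y)) (C \<times> PiE {..n} (\<lambda>_. C))"
    by (rule inj_combinator) simp
  show ?thesis
    unfolding atMost_Suc PiE_insert_eq
    by (subst sum.reindex[OF inj], subst sum.swap, simp add: sum.cartesian_product case_prod_unfold)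
qed

text \<open>The tail factor with parameter \<open>m\<close> makes the induction work: the last step
  of a path is absorbed into the tail, trading \<open>(Suc n, m)\<close> for
  \<open>(n, Suc m)\<close>. For \<open>m = 0\<close> the factor is 1 on paths off \<open>A\<close>,
  leaving plain path probabilities.\<close>

lemma sum_path_weights:
  fixes T :: "real ^ 'n::finite ^ 'n"
  shows "(\<Sum>x\<in>PiE {..n} (\<lambda>_. - A).
      (if x 0 = z then (\<Prod>i<n. T $ (x i) $ (x (Suc i))) else 0) * survival A T m (x n)) =
    survival A T (n + m) z"
proof (induction n arbitrary: m)
  case 0
  have "PiE {..0::nat} (\<lambda>_. - A) = (\<lambda>y. (\<lambda>_. undefined)(0 := y)) ` (- A)"
    unfolding atMost_0 PiE_insert_eq by auto
  moreover have "inj_on (\<lambda>y. (\<lambda>_::nat. undefined)(0 := y)) (- A)"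
    by (auto simp: inj_on_def fun_eq_iff)
  ultimately show ?case
    by (simp add: sum.reindex if_distrib[of "\<lambda>u. u * _"] sum.delta survival_target cong: if_cong)
next
  case (Suc n)
  have ind: "indicator (- A) y * survival A T m y = survival A T m y" for y
    by (cases "y \<in> A") (auto simp: survival_target)
  have "(\<Sum>x\<in>PiE {..Suc n} (\<lambda>_. - A).
      (if x 0 = z then (\<Prod>i<Suc n. T $ (x i) $ (x (Suc i))) else 0) * survival A T m (x (Suc n))) =
    (\<Sum>x\<in>PiE {..n} (\<lambda>_. - A). \<Sum>y\<in>-A.
      (if x 0 = z then (\<Prod>i<n. T $ (x i) $ (x (Suc i))) else 0) *
      (T $ (x n) $ y * survival A T m y))"
    unfolding sum_paths_Suc by (intro sum.cong refl) (simp add: mult.assoc)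
  also have "\<dots> = (\<Sum>x\<in>PiE {..n} (\<lambda>_. - A).
      (if x 0 = z then (\<Prod>i<n. T $ (x i) $ (x (Suc i))) else 0) * survival A T (Suc m) (x n))"
  proof (intro sum.cong refl)
    fix x :: "nat \<Rightarrow> 'n" assume "x \<in> PiE {..n} (\<lambda>_. - A)"
    then have "x n \<notin> A" by (auto simp: PiE_iff)
    then have "survival A T (Suc m) (x n) = (\<Sum>y\<in>-A. T $ (x n) $ y * survival A T m y)"
      by (auto simp: survival_target intro!: sum.mono_neutral_right)
    then show "(\<Sum>y\<in>-A. (if x 0 = z then (\<Prod>i<n. T $ (x i) $ (x (Suc i))) else 0) *
        (T $ (x n) $ y * survival A T m y)) =
      (if x 0 = z then (\<Prod>i<n. T $ (x i) $ (x (Suc i))) else 0) * survival A T (Suc m) (x n)"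
      by (simp only: sum_distrib_left)
  qed
  finally show ?case
    using Suc.IH[of "Suc m"] by simp
qed

lemma sets_space_markov_chain:
  "transition_matrix T \<Longrightarrow> sets (markov_chain T z) = sets (PiM UNIV (\<lambda>_. count_space UNIV))"
  "transition_matrix T \<Longrightarrow> space (markov_chain T z) = UNIV"
proof -
  assume "transition_matrix T"
  then interpret IT: Ionescu_Tulcea "chain_kernel T z" "\<lambda>_. count_space UNIV"
    by (rule Ionescu_Tulcea_chain_kernel)
  show "sets (markov_chain T z) = sets (PiM UNIV (\<lambda>_. count_space UNIV))"
    "space (markov_chain T z) = UNIV"
    by (simp_all add: markov_chain_def space_PiM)
qed

text \<open>The event is a finite disjoint union of cylinders over paths in \<open>- A\<close>,
  measured by \<open>emeasure_markov_chain_path\<close>; \<open>sum_path_weights\<close> with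
  \<open>m = 0\<close> adds them up.\<close>

lemma emeasure_markov_chain_survival:
  fixes T :: "real ^ 'n::finite ^ 'n"
  assumes T: "transition_matrix T"
  shows "emeasure (markov_chain T z) {\<omega>. \<forall>i\<le>n. \<omega> i \<notin> A} = ennreal (survival A T n z)"
proof -
  let ?P = "PiE {..n} (\<lambda>_. - A)"
  let ?C = "\<lambda>x. {\<omega>. \<forall>i\<le>n. \<omega> i = x i}"
  have "{\<omega>. \<forall>i\<le>n. \<omega> i \<notin> A} = (\<Union>x\<in>?P. ?C x)" (is "?L = ?R")
  proof
    show "?L \<subseteq> ?R"
    proof
      fix \<omega> assume "\<omega> \<in> ?L"
      then have "restrict \<omega> {..n} \<in> ?P" "\<omega> \<in> ?C (restrict \<omega> {..n})" by auto
      then show "\<omega> \<in> ?R" by blast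
    qed
    show "?R \<subseteq> ?L" by (auto simp: PiE_iff)
  qed
  moreover have "disjoint_family_on ?C ?P"
  proof (unfold disjoint_family_on_def, intro ballI impI)
    fix x y assume "x \<in> ?P" "y \<in> ?P" "x \<noteq> y"
    then obtain i where "i \<le> n" "x i \<noteq> y i" by (metis PiE_ext atMost_iff)
    then show "?C x \<inter> ?C y = {}" by force
  qed
  moreover have "?C ` ?P \<subseteq> sets (markov_chain T z)"
    unfolding sets_space_markov_chain(1)[OF T]
  proof safe
    fix x :: "nat \<Rightarrow> 'n"
    have "{\<omega> \<in> space (PiM UNIV (\<lambda>_. count_space (UNIV :: 'n set))). \<forall>i\<le>n. \<omega> i = x i}
        \<in> sets (PiM UNIV (\<lambda>_. count_space UNIV))"
      by measurable
    then show "?C x \<in> sets (PiM UNIV (\<lambda>_. count_space UNIV))"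
      by (simp add: space_PiM)
  qed
  ultimately have "emeasure (markov_chain T z) {\<omega>. \<forall>i\<le>n. \<omega> i \<notin> A} =
      (\<Sum>x\<in>?P. emeasure (markov_chain T z) (?C x))"
    by (simp add: sum_emeasure finite_PiE)
  also have "\<dots> = (\<Sum>x\<in>?P. ennreal (if x 0 = z then \<Prod>i<n. T $ (x i) $ (x (Suc i)) else 0))"
    by (intro sum.cong refl)
       (simp add: emeasure_markov_chain_path[OF T] prod_ennreal transition_matrix_nonneg[OF T])
  also have "\<dots> = ennreal (\<Sum>x\<in>?P. if x 0 = z then \<Prod>i<n. T $ (x i) $ (x (Suc i)) else 0)"
    by (intro sum_ennreal) (auto intro!: prod_nonneg transition_matrix_nonneg[OF T])
  also have "(\<Sum>x\<in>?P. if x 0 = z then \<Prod>i<n. T $ (x i) $ (x (Suc i)) else 0) = survival A T n z"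
    using sum_path_weights[where n = n and m = 0 and A = A and T = T and z = z, symmetric]
    by (auto simp: PiE_iff intro!: sum.cong)
  finally show ?thesis .
qed

section \<open>Hitting times and their expectations\<close>

lemma less_hitting_time_iff: "enat n < hitting_time A \<omega> \<longleftrightarrow> (\<forall>i\<le>n. \<omega> i \<notin> A)"
proof
  assume "enat n < hitting_time A \<omega>"
  then show "\<forall>i\<le>n. \<omega> i \<notin> A"
    unfolding hitting_time_def
    by (metis (mono_tags, lifting) Inf_lower enat_ord_simps(1) imageI leD mem_Collect_eq order_trans)
next
  assume *: "\<forall>i\<le>n. \<omega> i \<notin> A"
  have "enat (Suc n) \<le> hitting_time A \<omega>"
    unfolding hitting_time_def
  proof (rule Inf_greatest)
    fix x assume "x \<in> enat ` {n. \<omega> n \<in> A}"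
    with * show "enat (Suc n) \<le> x" by (auto simp: not_less_eq_eq[symmetric])
  qed
  then show "enat n < hitting_time A \<omega>"
    by (metis Suc_ile_eq)
qed

text \<open>With the infimum written as a \<open>LEAST\<close>, and as \<infinity> on paths missing
  \<open>A\<close>, measurability is automatic.\<close>

lemma measurable_hitting_time:
  "hitting_time A \<in> measurable (PiM UNIV (\<lambda>_. count_space (UNIV :: 'n::finite set))) (count_space UNIV)"
proof -
  have "hitting_time A =
      (\<lambda>\<omega>. if \<exists>n. \<omega> n \<in> A then enat (LEAST n. \<omega> n \<in> A) else \<infinity>)"
  proof
    fix \<omega>
    show "hitting_time A \<omega> = (if \<exists>n. \<omega> n \<in> A then enat (LEAST n. \<omega> n \<in> A) else \<infinity>)"
    proof (cases "\<exists>n. \<omega> n \<in> A")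
      case True
      then have "\<omega> (LEAST n. \<omega> n \<in> A) \<in> A" by (rule LeastI_ex)
      then have "hitting_time A \<omega> = enat (LEAST n. \<omega> n \<in> A)"
        unfolding hitting_time_def by (intro antisym Inf_lower Inf_greatest) (auto intro: Least_le)
      with True show ?thesis by simp
    qed (simp add: hitting_time_def Inf_enat_def)
  qed
  moreover have "(\<lambda>\<omega>. if \<exists>n. \<omega> n \<in> A then enat (LEAST n. \<omega> n \<in> A) else \<infinity>)
      \<in> measurable (PiM UNIV (\<lambda>_. count_space (UNIV :: 'n set))) (count_space UNIV)"
    by measurable
  ultimately show ?thesis by simp
qed

text \<open>Tail-sum formula for a variable with values in \<open>enat\<close>: the events that the
  hitting time exceeds \<open>n\<close> are the survival events.\<close>

lemma expected_hitting_time_eq_suminf: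
  assumes T: "transition_matrix T"
  shows "expected_hitting_time T A z = (\<Sum>n. ennreal (survival A T n z))"
proof -
  have "hitting_time A \<in> measurable (markov_chain T z) (count_space UNIV)"
    using measurable_hitting_time measurable_cong_sets[OF sets_space_markov_chain(1)[OF T] refl] by blast
  from nn_integral_enat_function[OF this] show ?thesis
    unfolding expected_hitting_time_def
    by (simp add: sets_space_markov_chain(2)[OF T] less_hitting_time_iff emeasure_markov_chain_survival[OF T])
qed

lemma expected_hitting_time_eq_suminf_real:
  assumes "transition_matrix T" "summable (\<lambda>n. survival A T n z)"
  shows "expected_hitting_time T A z = ennreal (\<Sum>n. survival A T n z)"
  using assms by (simp add: expected_hitting_time_eq_suminf suminf_ennreal2 survival_nonneg)

lemma expected_hitting_time_infinite:
  assumes T: "transition_matrix T" and c: "c > 0" "\<And>n. c \<le> survival A T n z"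
  shows "expected_hitting_time T A z = \<infinity>"
proof (rule ccontr)
  assume "expected_hitting_time T A z \<noteq> \<infinity>"
  then have "summable (\<lambda>n. survival A T n z)"
    by (intro summable_suminf_not_top survival_nonneg[OF T])
       (simp add: expected_hitting_time_eq_suminf[OF T])
  then have "(\<lambda>n. survival A T n z) \<longlonglongrightarrow> 0"
    by (rule summable_LIMSEQ_zero)
  then have "c \<le> 0"
    using c(2) by (intro LIMSEQ_le_const) auto
  with c show False by simp
qed

text \<open>First-step analysis. Summability is asked only at successors of nonzero probability:
  elsewhere the factor 0 removes the series, even a divergent one whose \<open>suminf\<close>
  carries no meaning.\<close>

lemma suminf_survival_step:
  assumes T: "transition_matrix T" and z: "z \<notin> A"
    and sm: "\<And>y. T $ z $ y \<noteq> 0 \<Longrightarrow> summable (\<lambda>n. survival A T n y)"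
  shows "(\<Sum>n. survival A T n z) = 1 + (\<Sum>y\<in>UNIV. T $ z $ y * (\<Sum>n. survival A T n y))"
proof -
  have sm': "summable (\<lambda>n. T $ z $ y * survival A T n y)" for y
    using sm[of y] by (cases "T $ z $ y = 0") (auto intro: summable_mult)
  have eq: "survival A T (Suc n) z = (\<Sum>y\<in>UNIV. T $ z $ y * survival A T n y)" for n
    using z by simp
  have "summable (\<lambda>n. survival A T (Suc n) z)"
    unfolding eq by (intro summable_sum sm')
  then have "(\<Sum>n. survival A T n z) = (\<Sum>n. survival A T (Suc n) z) + survival A T 0 z"
    using suminf_split_head[of "\<lambda>n. survival A T n z"]
      summable_Suc_iff[of "\<lambda>n. survival A T n z"] by (simp del: survival.simps)
  also have "(\<Sum>n. survival A T (Suc n) z) = (\<Sum>y\<in>UNIV. \<Sum>n. T $ z $ y * survival A T n y)"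
    unfolding eq by (intro suminf_sum sm')
  also have "\<dots> = (\<Sum>y\<in>UNIV. T $ z $ y * (\<Sum>n. survival A T n y))"
  proof (intro sum.cong refl)
    fix y
    show "(\<Sum>n. T $ z $ y * survival A T n y) = T $ z $ y * (\<Sum>n. survival A T n y)"
      by (cases "T $ z $ y = 0") (auto intro!: suminf_mult sm)
  qed
  finally show ?thesis using z by simp
qed

text \<open>A subharmonic function vanishing off \<open>S\<close> is dominated by a multiple of the survival
  probability at every time, hence by its limit \<open>0\<close>.\<close>

lemma subharmonic_nonpos:
  fixes w :: "'n::finite \<Rightarrow> real"
  assumes T: "transition_matrix T" and S: "S \<inter> A = {}"
    and sm: "\<And>z. z \<in> S \<Longrightarrow> summable (\<lambda>n. survival A T n z)"
    and off: "\<And>z. z \<notin> S \<Longrightarrow> w z = 0"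
    and sub: "\<And>z. z \<in> S \<Longrightarrow> w z \<le> (\<Sum>y\<in>UNIV. T $ z $ y * w y)"
  shows "w z \<le> 0"
proof (cases "z \<in> S")
  case True
  define C where "C = (\<Sum>y\<in>UNIV. \<bar>w y\<bar>)"
  have C: "0 \<le> C" "w y \<le> C" for y
    using member_le_sum[where i = y and A = UNIV and f = "\<lambda>y. \<bar>w y\<bar>"] by (auto simp: C_def intro: sum_nonneg)
  \<comment> \<open>At time 0 survival is 1 on \<open>S\<close>, which is disjoint from
    \<open>A\<close>. Each further step applies \<open>T\<close> to both sides; off \<open>S\<close>
    the left side is 0.\<close>
  have "w x \<le> C * survival A T n x" for n x
  proof (induction n arbitrary: x)
    case 0
    show ?case using C(1) C(2)[of x] off[of x] S by (cases "x \<in> S") (auto simp: indicator_def disjoint_iff)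
  next
    case (Suc n)
    show ?case
    proof (cases "x \<in> S")
      case True
      have "w x \<le> (\<Sum>y\<in>UNIV. T $ x $ y * w y)"
        by (rule sub[OF True])
      also have "\<dots> \<le> (\<Sum>y\<in>UNIV. T $ x $ y * (C * survival A T n y))"
        by (intro sum_mono mult_left_mono Suc.IH transition_matrix_nonneg[OF T])
      also have "\<dots> = C * survival A T (Suc n) x"
        using True S by (auto simp: sum_distrib_left mult.left_commute)
      finally show ?thesis .
    qed (use off C survival_nonneg[OF T] in \<open>simp del: survival.simps\<close>)
  qed
  moreover have "(\<lambda>n. C * survival A T n z) \<longlonglongrightarrow> 0"
    using tendsto_mult_right_zero summable_LIMSEQ_zero[OF sm[OF True]] by blast
  ultimately show ?thesis
    by (intro LIMSEQ_le_const) auto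
qed (simp add: off)

section \<open>Submatrices\<close>

lemma inverse_on_matrix_inv_on:
  "invertible_on B M \<Longrightarrow> inverse_on B M (matrix_inv_on B M)"
  unfolding invertible_on_def matrix_inv_on_def by (rule someI_ex)

text \<open>Padding by the identity off \<open>B\<close> gives a block-diagonal full matrix
  \<open>M1\<close> with trivial kernel, to which the theory of square matrices applies. Its zero
  off-diagonal blocks make the products over \<open>UNIV\<close> collapse to sums over
  \<open>B\<close>.\<close>

lemma invertible_onI:
  fixes M :: "real ^ 'n::finite ^ 'n"
  assumes ker: "\<And>v z. (\<And>z. z \<notin> B \<Longrightarrow> v $ z = 0) \<Longrightarrow> (\<And>z. z \<in> B \<Longrightarrow> (M *v v) $ z = 0) \<Longrightarrow> v = 0"
  shows "invertible_on B M"
proof -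
  define M1 :: "real ^ 'n ^ 'n" where
    "M1 = (\<chi> i j. if i \<in> B \<and> j \<in> B then M $ i $ j else if i = j then 1 else 0)"
  have "v = 0" if v: "M1 *v v = 0" for v
  proof (rule ker)
    have comp: "(\<Sum>j\<in>UNIV. M1 $ i $ j * v $ j) = 0" for i
      using v by (simp add: vec_eq_iff matrix_vector_mult_def)
    show off: "v $ z = 0" if "z \<notin> B" for z
    proof -
      have "(\<Sum>j\<in>UNIV. M1 $ z $ j * v $ j) = (\<Sum>j\<in>UNIV. if z = j then v $ j else 0)"
        using that by (intro sum.cong) (auto simp: M1_def)
      then show ?thesis using comp[of z] by simp
    qed
    show "(M *v v) $ z = 0" if "z \<in> B" for z
    proof -
      have "(M *v v) $ z = (\<Sum>j\<in>UNIV. M1 $ z $ j * v $ j)"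
        unfolding matrix_vector_mult_def using that off
        by (auto simp: M1_def intro!: sum.cong)
      then show ?thesis using comp by simp
    qed
  qed
  then obtain N where N: "N ** M1 = mat 1"
    using matrix_left_invertible_ker[of M1] by blast
  then have N': "M1 ** N = mat 1"
    by (simp add: matrix_left_right_inverse)
  have "inverse_on B M N"
    unfolding inverse_on_def
  proof (intro conjI ballI)
    fix i j assume ij: "i \<in> B" "j \<in> B"
    have "(\<Sum>k\<in>B. M $ i $ k * N $ k $ j) = (\<Sum>k\<in>UNIV. M1 $ i $ k * N $ k $ j)"
      using ij by (intro sum.mono_neutral_cong_left) (auto simp: M1_def)
    then show "(\<Sum>k\<in>B. M $ i $ k * N $ k $ j) = (if i = j then 1 else 0)"
      using N' by (simp add: matrix_matrix_mult_def mat_def vec_eq_iff)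
    have "(\<Sum>k\<in>B. N $ i $ k * M $ k $ j) = (\<Sum>k\<in>UNIV. N $ i $ k * M1 $ k $ j)"
      using ij by (intro sum.mono_neutral_cong_left) (auto simp: M1_def)
    then show "(\<Sum>k\<in>B. N $ i $ k * M $ k $ j) = (if i = j then 1 else 0)"
      using N by (simp add: matrix_matrix_mult_def mat_def vec_eq_iff)
  qed
  then show ?thesis by (auto simp: invertible_on_def)
qed

text \<open>Apply \<open>M'\<close> to the system solved by \<open>h\<close> and exchange the sums;
  the left-inverse equations leave \<open>h\<close>.\<close>

lemma mult_vec_on_inverse:
  assumes inv: "inverse_on B M M'" and z: "z \<in> B"
    and eq: "\<And>i. i \<in> B \<Longrightarrow> (\<Sum>j\<in>B. M $ i $ j * h j) = v $ i"
  shows "mult_vec_on B M' v $ z = h z"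
proof -
  have "mult_vec_on B M' v $ z = (\<Sum>j\<in>B. M' $ z $ j * (\<Sum>k\<in>B. M $ j $ k * h k))"
    by (simp add: mult_vec_on_def eq)
  also have "\<dots> = (\<Sum>k\<in>B. (\<Sum>j\<in>B. M' $ z $ j * M $ j $ k) * h k)"
    unfolding sum_distrib_left sum_distrib_right by (subst sum.swap) (simp add: mult.assoc)
  also have "\<dots> = (\<Sum>k\<in>B. (if z = k then 1 else 0) * h k)"
    using inv z by (intro sum.cong) (auto simp: inverse_on_def)
  also have "\<dots> = h z"
    using z by (simp add: if_distrib[of "\<lambda>u. u * _"] sum.delta cong: if_cong)
  finally show ?thesis .
qed

section \<open>Upper and lower transition operators\<close>

locale transition_set =
  fixes \<T> :: "(real ^ 'n::finite ^ 'n) set"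
  assumes nonempty: "\<T> \<noteq> {}"
    and transition: "\<And>T. T \<in> \<T> \<Longrightarrow> transition_matrix T"
    and compact: "compact \<T>"
    and separate: "separately_specified_rows \<T>"
begin

text \<open>Choices made separately for each state combine into one member of \<open>\<T>\<close>:
  take row \<open>z\<close> from the matrix chosen for \<open>z\<close>. This is where separate
  specification of the rows enters.\<close>

lemma row_selection:
  assumes "\<And>z. \<exists>T\<in>\<T>. P z (T $ z)"
  shows "\<exists>T\<in>\<T>. \<forall>z. P z (T $ z)"
proof -
  from assms obtain F where F: "\<And>z. F z \<in> \<T>" "\<And>z. P z (F z $ z)" by metis
  obtain R where R: "(\<forall>z. \<forall>p\<in>R z. prob_mass_function p) \<and>
      \<T> = {T. transition_matrix T \<and> (\<forall>z. T $ z \<in> R z)}"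
    using separate unfolding separately_specified_rows_def ..
  have row: "F z $ z \<in> R z" for z
    using F(1)[of z] R by blast
  then have "prob_mass_function (F z $ z)" for z
    using R by blast
  with row have "(\<chi> z. F z $ z) \<in> \<T>"
    by (subst conjunct2[OF R]) (simp add: transition_matrix_def)
  with F(2) show ?thesis by (intro bexI[of _ "\<chi> z. F z $ z"]) auto
qed

lemma continuous_on_apply: "continuous_on \<T> (\<lambda>T. (T *v f) $ z)"
  unfolding matrix_vector_mult_def by (auto intro!: continuous_intros)

text \<open>A continuous function on a nonempty compact set attains its maximum. The maximiser may
  depend on \<open>z\<close>; \<open>row_selection\<close> can merge the maximisers.\<close>

lemma upper_attained_at:
  "\<exists>T\<in>\<T>. upper_transition \<T> f $ z = (T *v f) $ z \<and>
    (\<forall>T'\<in>\<T>. (T' *v f) $ z \<le> (T *v f) $ z)"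
proof -
  obtain T where T: "T \<in> \<T>" "\<forall>T'\<in>\<T>. (T' *v f) $ z \<le> (T *v f) $ z"
    using continuous_attains_sup[OF compact nonempty continuous_on_apply] by blast
  then have "(SUP T\<in>\<T>. (T *v f) $ z) = (T *v f) $ z"
    by (intro cSup_eq_maximum) auto
  with T show ?thesis by (auto simp: upper_transition_def)
qed

lemma lower_attained_at:
  "\<exists>T\<in>\<T>. lower_transition \<T> f $ z = (T *v f) $ z \<and>
    (\<forall>T'\<in>\<T>. (T *v f) $ z \<le> (T' *v f) $ z)"
proof -
  obtain T where T: "T \<in> \<T>" "\<forall>T'\<in>\<T>. (T *v f) $ z \<le> (T' *v f) $ z"
    using continuous_attains_inf[OF compact nonempty continuous_on_apply] by blast
  then have "(INF T\<in>\<T>. (T *v f) $ z) = (T *v f) $ z"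
    by (intro cInf_eq_minimum) auto
  with T show ?thesis by (auto simp: lower_transition_def)
qed

lemma le_upper_transition: "T \<in> \<T> \<Longrightarrow> (T *v f) $ z \<le> upper_transition \<T> f $ z"
  using upper_attained_at[of f z] by auto

lemma lower_transition_le: "T \<in> \<T> \<Longrightarrow> lower_transition \<T> f $ z \<le> (T *v f) $ z"
  using lower_attained_at[of f z] by auto

lemma apply_mono:
  "T \<in> \<T> \<Longrightarrow> (\<And>y. f $ y \<le> g $ y) \<Longrightarrow> (T *v f) $ z \<le> (T *v g) $ z"
  by (auto simp: matrix_vector_mult_def intro!: sum_mono mult_left_mono
      transition_matrix_nonneg transition)

lemma apply_nonneg: "T \<in> \<T> \<Longrightarrow> (\<And>y. 0 \<le> f $ y) \<Longrightarrow> 0 \<le> (T *v f) $ z"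
  by (auto simp: matrix_vector_mult_def intro!: sum_nonneg mult_nonneg_nonneg
      transition_matrix_nonneg transition)

lemma lower_transition_mono:
  assumes "\<And>y. f $ y \<le> g $ y"
  shows "lower_transition \<T> f $ z \<le> lower_transition \<T> g $ z"
  using lower_attained_at[of g z] lower_transition_le[of _ f z] apply_mono[OF _ assms, of _ z]
  by (metis order_trans)

lemma lower_transition_nonneg: "(\<And>y. 0 \<le> f $ y) \<Longrightarrow> 0 \<le> lower_transition \<T> f $ z"
  using lower_attained_at[of f z] apply_nonneg[of _ f z] by auto

lemma upper_transition_nonneg: "(\<And>y. 0 \<le> f $ y) \<Longrightarrow> 0 \<le> upper_transition \<T> f $ z"
  using upper_attained_at[of f z] apply_nonneg[of _ f z] by auto

lemma upper_transition_posI: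
  assumes "T \<in> \<T>" "T $ z $ y > 0" "f $ y > 0" "\<And>x. 0 \<le> f $ x"
  shows "upper_transition \<T> f $ z > 0"
proof -
  have "0 < T $ z $ y * f $ y" using assms by simp
  also have "\<dots> \<le> (T *v f) $ z"
    unfolding matrix_vector_mult_def vec_lambda_beta using assms
    by (intro member_le_sum[where f = "\<lambda>y. T $ z $ y * f $ y"])
       (auto intro!: mult_nonneg_nonneg transition_matrix_nonneg transition)
  also have "\<dots> \<le> upper_transition \<T> f $ z" by (rule le_upper_transition) fact
  finally show ?thesis .
qed

lemma upper_transition_posE:
  assumes "upper_transition \<T> f $ z > 0" "\<And>x. 0 \<le> f $ x"
  obtains T y where "T \<in> \<T>" "T $ z $ y > 0" "f $ y > 0"
proof -
  obtain T where T: "T \<in> \<T>" "(\<Sum>y\<in>UNIV. T $ z $ y * f $ y) > 0"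
    using upper_attained_at[of f z] assms(1) by (auto simp: matrix_vector_mult_def)
  then obtain y where "T $ z $ y * f $ y > 0"
    by (meson not_less sum_nonpos)
  with T(1) assms(2)[of y] transition_matrix_nonneg[OF transition[OF T(1)], of z y] that show thesis
    by (metis less_eq_real_def mult_zero_left mult_zero_right)
qed

end

section \<open>Good and bad states\<close>

locale closed_target = transition_set \<T> for \<T> :: "(real ^ 'n::finite ^ 'n) set" +
  fixes A :: "'n set"
  assumes closed: "closed_states \<T> A"
begin

abbreviation avoiding where "avoiding \<equiv> avoiding_states \<T> A"
abbreviation bad where "bad \<equiv> bad_states \<T> A"
abbreviation lower_iter where "lower_iter n \<equiv> (lower_transition \<T> ^^ n) (indicator_vec A)"
abbreviation upper_iter where "upper_iter n \<equiv> (upper_transition \<T> ^^ n) (indicator_vec avoiding)"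

section \<open>Iterates of the transition operators on indicators\<close>

lemma leaving_target: "T \<in> \<T> \<Longrightarrow> x \<in> A \<Longrightarrow> y \<notin> A \<Longrightarrow> T $ x $ y = 0"
  using closed by (auto simp: closed_states_def)

lemma avoiding_not_target: "z \<in> avoiding \<Longrightarrow> z \<notin> A"
  by (simp add: avoiding_states_def)

lemma bad_not_target: "z \<in> bad \<Longrightarrow> z \<notin> A"
  by (auto simp: bad_states_def avoiding_states_def unsafe_states_def)

lemma lower_iter_nonneg: "0 \<le> lower_iter n $ z"
  by (induction n arbitrary: z) (auto simp: indicator_vec_def intro: lower_transition_nonneg)

lemma upper_iter_nonneg: "0 \<le> upper_iter n $ z"
  by (induction n arbitrary: z) (auto simp: indicator_vec_def intro: upper_transition_nonneg)

text \<open>As \<open>A\<close> is closed, the row at \<open>z\<close> puts its whole mass on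
  \<open>A\<close>, where the previous iterate is 1.\<close>

lemma lower_iter_target: "z \<in> A \<Longrightarrow> lower_iter n $ z = 1"
proof (induction n arbitrary: z)
  case (Suc n)
  obtain T where T: "T \<in> \<T>" "lower_iter (Suc n) $ z = (\<Sum>y\<in>UNIV. T $ z $ y * lower_iter n $ y)"
    using lower_attained_at[of "lower_iter n" z] by (auto simp: matrix_vector_mult_def)
  have "(\<Sum>y\<in>UNIV. T $ z $ y * lower_iter n $ y) = (\<Sum>y\<in>UNIV. T $ z $ y)"
    using Suc.IH leaving_target[OF T(1) Suc.prems]
    by (intro sum.cong refl) (metis mult.right_neutral mult_zero_left)
  with T transition_matrix_row_sum[OF transition[OF T(1)]] show ?case by simp
qed (simp add: indicator_vec_def)

text \<open>From \<open>A\<close> only \<open>A\<close> can be entered, and it contains no avoiding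
  state. Hence a positive upper iterate excludes membership in \<open>A\<close>.\<close>

lemma upper_iter_target: "z \<in> A \<Longrightarrow> upper_iter n $ z = 0"
proof (induction n arbitrary: z)
  case (Suc n)
  obtain T where T: "T \<in> \<T>" "upper_iter (Suc n) $ z = (\<Sum>y\<in>UNIV. T $ z $ y * upper_iter n $ y)"
    using upper_attained_at[of "upper_iter n" z] by (auto simp: matrix_vector_mult_def)
  moreover have "T $ z $ y * upper_iter n $ y = 0" for y
    using Suc.IH leaving_target[OF T(1) Suc.prems] by (cases "y \<in> A") auto
  ultimately show ?case by simp
qed (auto simp: indicator_vec_def avoiding_states_def)

text \<open>The first iterate dominates the indicator because \<open>A\<close> is closed;
  monotonicity of the operator propagates this.\<close>

lemma lower_iter_mono: "m \<le> n \<Longrightarrow> lower_iter m $ z \<le> lower_iter n $ z"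
proof (rule lift_Suc_mono_le[of "\<lambda>n. lower_iter n $ z"])
  show "lower_iter n $ z \<le> lower_iter (Suc n) $ z" for n
  proof (induction n arbitrary: z)
    case 0
    show ?case
    proof (cases "z \<in> A")
      case True
      then show ?thesis using lower_iter_target[of z 0] lower_iter_target[of z "Suc 0"] by simp
    next
      case False
      then have "lower_iter 0 $ z = 0" by (simp add: indicator_vec_def)
      then show ?thesis using lower_iter_nonneg[of "Suc 0" z] by simp
    qed
  next
    case (Suc n)
    then show ?case by (auto intro: lower_transition_mono)
  qed
qed

text \<open>Iterate 0 lies outside the range of \<open>lower_reachable\<close> and vanishes because
  avoiding states are not in \<open>A\<close>.\<close>

lemma lower_iter_avoiding: "z \<in> avoiding \<Longrightarrow> lower_iter n $ z = 0"
proof (cases "n = 0")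
  case False
  assume "z \<in> avoiding"
  with False have "\<not> lower_iter n $ z > 0"
    unfolding avoiding_states_def lower_reachable_def by (simp add: Suc_le_eq) (metis neq0_conv)
  then show ?thesis using lower_iter_nonneg[of n z] by simp
qed (auto simp: avoiding_states_def indicator_vec_def)

text \<open>Each non-avoiding state has its own positive iterate; monotonicity and finiteness of the
  state space give a common index.\<close>

lemma lower_iter_uniformly_pos:
  obtains N \<epsilon> where "\<epsilon> > 0" "\<And>z. z \<notin> avoiding \<Longrightarrow> \<epsilon> \<le> lower_iter N $ z"
proof -
  have "\<exists>n. z \<notin> avoiding \<longrightarrow> lower_iter n $ z > 0" for z
  proof (cases "z \<in> A")
    case True
    then show ?thesis using lower_iter_target[of z 0] by (intro exI[of _ 0]) (simp add: indicator_vec_def)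
  next
    case False
    then show ?thesis by (auto simp: avoiding_states_def lower_reachable_def)
  qed
  then obtain n where n: "\<And>z. z \<notin> avoiding \<Longrightarrow> lower_iter (n z) $ z > 0" by metis
  define N where "N = Max (range n)"
  have pos: "lower_iter N $ z > 0" if "z \<notin> avoiding" for z
    using n[OF that] lower_iter_mono[of "n z" N z] by (auto simp: N_def intro: less_le_trans)
  \<comment> \<open>The inserted 1 keeps the set nonempty in case every state is avoiding.\<close>
  define \<epsilon> where "\<epsilon> = Min (insert 1 ((\<lambda>z. lower_iter N $ z) ` (- avoiding)))"
  show thesis
  proof
    show "\<epsilon> > 0" using pos by (auto simp: \<epsilon>_def)
    show "\<epsilon> \<le> lower_iter N $ z" if "z \<notin> avoiding" for z
      using that by (auto simp: \<epsilon>_def)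
  qed
qed

section \<open>Infinite hitting times from bad states\<close>

text \<open>The matrix attaining iterate \<open>Suc N\<close> at \<open>z\<close> yields a vanishing
  sum of nonnegative terms; iterate \<open>N\<close> is positive off \<open>avoiding\<close>, so the
  row has no weight there.\<close>

lemma avoiding_closed_selection:
  assumes z: "z \<in> avoiding"
  shows "\<exists>T\<in>\<T>. \<forall>y. y \<notin> avoiding \<longrightarrow> T $ z $ y = 0"
proof -
  obtain N \<epsilon> where pos: "\<epsilon> > 0" "\<And>z. z \<notin> avoiding \<Longrightarrow> \<epsilon> \<le> lower_iter N $ z"
    by (rule lower_iter_uniformly_pos) blast
  obtain T where T: "T \<in> \<T>" "lower_iter (Suc N) $ z = (\<Sum>y\<in>UNIV. T $ z $ y * lower_iter N $ y)"
    using lower_attained_at[of "lower_iter N" z] by (auto simp: matrix_vector_mult_def)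
  then have "(\<Sum>y\<in>UNIV. T $ z $ y * lower_iter N $ y) = 0"
    using lower_iter_avoiding[OF z, of "Suc N"] by simp
  then have "T $ z $ y * lower_iter N $ y = 0" for y
    by (subst (asm) sum_nonneg_eq_0_iff)
       (auto intro!: mult_nonneg_nonneg lower_iter_nonneg transition_matrix_nonneg transition T(1))
  then have "T $ z $ y = 0" if "y \<notin> avoiding" for y
    using pos(1) pos(2)[OF that] by (metis mult_eq_0_iff not_less)
  with T(1) show ?thesis by blast
qed

text \<open>With \<open>bad_upper_iter\<close> this characterises the bad states by the positivity
  of some upper iterate, where iterate 0 accounts for the avoiding states.\<close>

lemma upper_iter_bad:
  assumes "upper_iter n $ z > 0"
  shows "z \<in> bad"
proof (cases n)
  case 0
  with assms show ?thesis by (auto simp: indicator_vec_def bad_states_def indicator_def split: if_splits)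
next
  case (Suc m)
  then have "1 \<le> n" by simp
  then have "upper_reachable \<T> avoiding z" using assms unfolding upper_reachable_def by blast
  moreover have "z \<notin> A" using assms upper_iter_target[of z n] by auto
  ultimately show ?thesis by (auto simp: bad_states_def unsafe_states_def)
qed

lemma bad_upper_iter: "z \<in> bad \<Longrightarrow> \<exists>n. upper_iter n $ z > 0"
proof (cases "z \<in> avoiding")
  case True
  then show ?thesis by (intro exI[of _ 0]) (simp add: indicator_vec_def)
qed (auto simp: bad_states_def unsafe_states_def upper_reachable_def)

text \<open>A transition of positive probability into a bad state would make the next upper iterate
  positive at \<open>z\<close>.\<close>

lemma good_to_bad: "T \<in> \<T> \<Longrightarrow> z \<notin> bad \<Longrightarrow> y \<in> bad \<Longrightarrow> T $ z $ y = 0"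
proof (rule ccontr)
  assume T: "T \<in> \<T>" and z: "z \<notin> bad" and y: "y \<in> bad" and "T $ z $ y \<noteq> 0"
  then have "T $ z $ y > 0"
    using transition_matrix_nonneg[OF transition[OF T], of z y] by simp
  moreover obtain n where "upper_iter n $ y > 0" using bad_upper_iter[OF y] by blast
  ultimately have "upper_iter (Suc n) $ z > 0"
    using upper_transition_posI[OF T, of z y "upper_iter n"] upper_iter_nonneg by simp
  with z upper_iter_bad show False by blast
qed

text \<open>One matrix serves all bad states: on the avoiding states its rows stay there, and from any
  other bad state it decreases, with positive probability, the number of steps needed to reach
  them.\<close>

lemma bad_matrix:
  "\<exists>T\<in>\<T>. \<forall>z\<in>bad. expected_hitting_time T A z = \<infinity>"
proof -
  define d where "d z = (LEAST n. upper_iter n $ z > 0)" for z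
  have d: "upper_iter (d z) $ z > 0" if "z \<in> bad" for z
    unfolding d_def using bad_upper_iter[OF that] by (rule LeastI_ex)
  define P where "P z r \<longleftrightarrow> (z \<in> avoiding \<longrightarrow> (\<forall>y. y \<notin> avoiding \<longrightarrow> r $ y = 0)) \<and>
    (z \<in> bad - avoiding \<longrightarrow> (\<exists>y\<in>bad. r $ y > 0 \<and> d y < d z))" for z and r :: "real ^ 'n"
  have "\<exists>T\<in>\<T>. P z (T $ z)" for z
  proof -
    consider "z \<in> avoiding" | "z \<in> bad - avoiding" | "z \<notin> bad" "z \<notin> avoiding" by blast
    then show ?thesis
    proof cases
      case 1
      then show ?thesis using avoiding_closed_selection[of z] by (auto simp: P_def)
    next
      case 2
      then have "d z \<noteq> 0"
        using d[of z] by (intro notI) (simp add: indicator_vec_def)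
      then obtain m where m: "d z = Suc m" using not0_implies_Suc by blast
      then have "upper_transition \<T> (upper_iter m) $ z > 0" using d[of z] 2 by simp
      then obtain T y where T: "T \<in> \<T>" "T $ z $ y > 0" "upper_iter m $ y > 0"
        using upper_transition_posE[of "upper_iter m" z] upper_iter_nonneg by blast
      have "d y \<le> m" unfolding d_def by (rule Least_le) (rule T(3))
      with T m 2 upper_iter_bad[OF T(3)] show ?thesis
        unfolding P_def by (intro bexI[of _ T]) auto
    next
      case 3
      then show ?thesis using nonempty by (auto simp: P_def)
    qed
  qed
  then obtain T where T: "T \<in> \<T>" and P: "\<And>z. P z (T $ z)"
    using row_selection[of P] by blast
  note T' = transition[OF T]
  have avoid: "survival A T n z = 1" if "z \<in> avoiding" for n z
    using that
  proof (induction n arbitrary: z)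
    case (Suc n)
    have "(\<Sum>y\<in>UNIV. T $ z $ y * survival A T n y) = (\<Sum>y\<in>UNIV. T $ z $ y)"
      using P[of z] Suc by (intro sum.cong refl) (auto simp: P_def)
    then show ?case
      using Suc.prems avoiding_not_target transition_matrix_row_sum[OF T'] by auto
  qed (simp add: avoiding_not_target)
  have "\<exists>c>0. \<forall>n. c \<le> survival A T n z" if "z \<in> bad" for z
    using that
  proof (induction "d z" arbitrary: z rule: less_induct)
    case less
    show ?case
    proof (cases "z \<in> avoiding")
      case True
      then show ?thesis using avoid by (intro exI[of _ 1]) auto
    next
      case False
      then obtain y where y: "y \<in> bad" "T $ z $ y > 0" "d y < d z"
        using P[of z] less.prems by (auto simp: P_def)
      from less.hyps[OF y(3,1)] obtain c where c: "c > 0" "\<And>n. c \<le> survival A T n y" by blast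
      have zA: "z \<notin> A" using bad_not_target less.prems by blast
      \<comment> \<open>At time 0 survival is certain because \<open>z\<close> is not in
        \<open>A\<close>; at later times it can be achieved by stepping to \<open>y\<close> and
        surviving from there. The minimum covers both.\<close>
      have "min 1 (T $ z $ y * c) \<le> survival A T n z" for n
      proof (cases n)
        case (Suc m)
        have "T $ z $ y * c \<le> T $ z $ y * survival A T m y"
          using c y by (intro mult_left_mono) auto
        also have "\<dots> \<le> survival A T n z"
          using zA member_le_sum[where i = y and A = UNIV and f = "\<lambda>y. T $ z $ y * survival A T m y"]
          by (simp add: Suc survival_nonneg[OF T'] transition_matrix_nonneg[OF T'])
        finally show ?thesis by simp
      qed (use zA in simp)
      moreover have "min 1 (T $ z $ y * c) > 0" using c y by simp
      ultimately show ?thesis by blast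
    qed
  qed
  then show ?thesis
    using T expected_hitting_time_infinite[OF T'] by blast
qed

section \<open>Finite hitting times from good states\<close>

abbreviation good where "good \<equiv> - A - bad"

text \<open>Telescoping: applying any \<open>T \<in> \<T>\<close> to \<open>\<Sum>k<N. 1 - L\<^sup>k 1\<^sub>A\<close> turns it into at most
  \<open>\<Sum>k<N. 1 - L\<^bsup>k+1\<^esup> 1\<^sub>A\<close>, where \<open>L\<close> is the lower transition operator.\<close>

lemma supersolution:
  obtains g where "\<And>z. 0 \<le> g z"
    "\<And>T z. T \<in> \<T> \<Longrightarrow> z \<in> good \<Longrightarrow> 1 + (\<Sum>y\<in>UNIV. T $ z $ y * g y) \<le> g z"
proof -
  obtain N \<epsilon> where pos: "\<epsilon> > 0" "\<And>z. z \<notin> avoiding \<Longrightarrow> \<epsilon> \<le> lower_iter N $ z"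
    by (rule lower_iter_uniformly_pos) blast
  have le1: "lower_iter n $ z \<le> 1" for n z
  proof (induction n arbitrary: z)
    case (Suc n)
    obtain T where T: "T \<in> \<T>" using nonempty by blast
    have "lower_iter (Suc n) $ z \<le> (\<Sum>y\<in>UNIV. T $ z $ y * lower_iter n $ y)"
      using lower_transition_le[OF T, of "lower_iter n" z] by (simp add: matrix_vector_mult_def)
    also have "\<dots> \<le> (\<Sum>y\<in>UNIV. T $ z $ y)"
      using Suc by (intro sum_mono mult_left_le transition_matrix_nonneg[OF transition[OF T]])
    finally show ?case by (simp add: transition_matrix_row_sum[OF transition[OF T]])
  qed (simp add: indicator_vec_def indicator_def)
  \<comment> \<open>At a good state the telescoping gain is \<open>lower_iter N $ z\<close>, which
    is at least \<open>\<epsilon>\<close>; dividing by \<open>\<epsilon>\<close> normalises it to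
    1.\<close>
  define g where "g z = (\<Sum>k<N. 1 - lower_iter k $ z) / \<epsilon>" for z
  show thesis
  proof
    show "0 \<le> g z" for z
      using pos(1) le1 by (auto simp: g_def intro!: divide_nonneg_pos sum_nonneg)
    fix T z assume T: "T \<in> \<T>" and z: "z \<in> good"
    have "(\<Sum>y\<in>UNIV. T $ z $ y * (\<Sum>k<N. 1 - lower_iter k $ y)) =
        (\<Sum>k<N. (\<Sum>y\<in>UNIV. T $ z $ y) - (T *v lower_iter k) $ z)"
      unfolding sum_distrib_left
      by (subst sum.swap)
         (simp add: matrix_vector_mult_def sum_subtractf right_diff_distrib)
    also have "\<dots> \<le> (\<Sum>k<N. 1 - lower_iter (Suc k) $ z)"
      using lower_transition_le[OF T]
      by (intro sum_mono) (simp add: transition_matrix_row_sum[OF transition[OF T]])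
    also have "\<dots> = (\<Sum>k<N. 1 - lower_iter k $ z) - (\<Sum>k<N. lower_iter (Suc k) $ z - lower_iter k $ z)"
      by (simp add: sum_subtractf)
    also have "(\<Sum>k<N. lower_iter (Suc k) $ z - lower_iter k $ z) = lower_iter N $ z - lower_iter 0 $ z"
      by (rule sum_lessThan_telescope)
    also have "lower_iter 0 $ z = 0" using z by (simp add: indicator_vec_def)
    finally have "(\<Sum>y\<in>UNIV. T $ z $ y * (\<Sum>k<N. 1 - lower_iter k $ y)) \<le>
        (\<Sum>k<N. 1 - lower_iter k $ z) - \<epsilon>"
      using pos(2)[of z] z by (auto simp: bad_states_def)
    then have "(\<Sum>y\<in>UNIV. T $ z $ y * (\<Sum>k<N. 1 - lower_iter k $ y)) / \<epsilon> \<le> g z - 1"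
      using pos(1) by (simp add: g_def field_simps)
    then show "1 + (\<Sum>y\<in>UNIV. T $ z $ y * g y) \<le> g z"
      by (simp add: g_def flip: sum_divide_distrib)
  qed
qed

text \<open>Induction compares the one-step recursion with the supersolution: bad successors have
  probability 0, and on \<open>A\<close> the partial sums vanish. The bound is uniform in
  \<open>T\<close>, so the supremum over \<open>\<T>\<close> is finite.\<close>

lemma good_bound:
  obtains g where "\<And>T z n. T \<in> \<T> \<Longrightarrow> z \<notin> bad \<Longrightarrow> (\<Sum>k<n. survival A T k z) \<le> g z"
proof -
  obtain g where g: "\<And>z. 0 \<le> g z"
    "\<And>T z. T \<in> \<T> \<Longrightarrow> z \<in> good \<Longrightarrow> 1 + (\<Sum>y\<in>UNIV. T $ z $ y * g y) \<le> g z"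
    by (rule supersolution) blast
  show thesis
  proof
    fix T z n assume T: "T \<in> \<T>" and z: "z \<notin> bad"
    note T' = transition[OF T]
    from z show "(\<Sum>k<n. survival A T k z) \<le> g z"
    proof (induction n arbitrary: z)
      case (Suc n)
      show ?case
      proof (cases "z \<in> A")
        case False
        have "(\<Sum>k<Suc n. survival A T k z) = 1 + (\<Sum>y\<in>UNIV. T $ z $ y * (\<Sum>k<n. survival A T k y))"
          using False unfolding sum.lessThan_Suc_shift sum_distrib_left
          by (subst sum.swap) simp
        also have "\<dots> \<le> 1 + (\<Sum>y\<in>UNIV. T $ z $ y * g y)"
        proof (intro add_left_mono sum_mono)
          fix y
          show "T $ z $ y * (\<Sum>k<n. survival A T k y) \<le> T $ z $ y * g y"
            using good_to_bad[OF T Suc.prems, of y] Suc.IH[of y] transition_matrix_nonneg[OF T', of z y]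
            by (cases "y \<in> bad") (auto intro: mult_left_mono)
        qed
        also have "\<dots> \<le> g z" using g(2)[OF T] False Suc.prems by simp
        finally show ?thesis .
      qed (simp add: survival_target g(1) del: survival.simps)
    qed (simp add: g(1))
  qed
qed

lemma summable_survival:
  assumes "T \<in> \<T>" "z \<notin> bad"
  shows "summable (\<lambda>n. survival A T n z)"
proof -
  obtain g where "\<And>n. (\<Sum>k<n. survival A T k z) \<le> g z"
    using good_bound assms by metis
  then show ?thesis
    by (intro summableI_nonneg_bounded[where x = "g z"] survival_nonneg transition assms)
qed

lemma suminf_survival_good:
  assumes "T \<in> \<T>" "z \<in> good"
  shows "(\<Sum>n. survival A T n z) = 1 + (\<Sum>y\<in>UNIV. T $ z $ y * (\<Sum>n. survival A T n y))"
proof (rule suminf_survival_step[OF transition])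
  fix y assume "T $ z $ y \<noteq> 0"
  with assms good_to_bad have "y \<notin> bad" by blast
  with assms(1) show "summable (\<lambda>n. survival A T n y)" by (rule summable_survival)
qed (use assms in auto)

lemma good_matrix:
  "\<exists>T\<in>\<T>. \<forall>z\<in>good. \<forall>T'\<in>\<T>. (\<Sum>n. survival A T' n z) \<le> (\<Sum>n. survival A T n z)"
proof -
  define h where "h T z = (\<Sum>n. survival A T n z)" for T z
  \<comment> \<open>The default 0 is the true value on \<open>A\<close>. On bad states it is
    arbitrary, but rows of good states give them no weight.\<close>
  define H where "H z = (if z \<in> good then SUP T\<in>\<T>. h T z else 0)" for z
  have hA: "h T z = 0" if "z \<in> A" for T z
    using that by (simp add: h_def survival_target)
  have h_step: "h T z = 1 + (\<Sum>y\<in>UNIV. T $ z $ y * h T y)" if "T \<in> \<T>" "z \<in> good" for T z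
    unfolding h_def using that by (rule suminf_survival_good)
  obtain g where g: "\<And>T z n. T \<in> \<T> \<Longrightarrow> z \<notin> bad \<Longrightarrow> (\<Sum>k<n. survival A T k z) \<le> g z"
    by (rule good_bound) blast
  have "bdd_above ((\<lambda>T. h T z) ` \<T>)" if "z \<in> good" for z
    using that unfolding h_def
    by (intro bdd_aboveI2[where M = "g z"] suminf_le_const summable_survival g) auto
  then have h_le: "h T z \<le> H z" if "T \<in> \<T>" "z \<in> good" for T z
    using that by (auto simp: H_def intro: cSUP_upper)
  obtain T where T: "T \<in> \<T>" and
    opt: "\<And>z T'. T' \<in> \<T> \<Longrightarrow> (\<Sum>y\<in>UNIV. T' $ z $ y * H y) \<le> (\<Sum>y\<in>UNIV. T $ z $ y * H y)"
  proof -
    have "\<exists>T\<in>\<T>. \<forall>T'\<in>\<T>. (\<Sum>y\<in>UNIV. T' $ z $ y * H y) \<le> (\<Sum>y\<in>UNIV. T $ z $ y * H y)" for z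
      using upper_attained_at[of "\<chi> y. H y" z] by (auto simp: matrix_vector_mult_def)
    from row_selection[of "\<lambda>z r.
        \<forall>T'\<in>\<T>. (\<Sum>y\<in>UNIV. T' $ z $ y * H y) \<le> (\<Sum>y\<in>UNIV. r $ y * H y)", OF this]
    show thesis using that by blast
  qed
  \<comment> \<open>Bellman inequality: \<open>h T' = 1 + T' h T'\<close> is at most
    \<open>1 + T' H\<close>, hence at most \<open>1 + T H\<close> by the choice of \<open>T\<close>;
    then take the supremum over \<open>T'\<close>.\<close>
  have H_le: "H z \<le> 1 + (\<Sum>y\<in>UNIV. T $ z $ y * H y)" if z: "z \<in> good" for z
  proof -
    have "h T' z \<le> 1 + (\<Sum>y\<in>UNIV. T $ z $ y * H y)" if T': "T' \<in> \<T>" for T'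
    proof -
      have "T' $ z $ y * h T' y \<le> T' $ z $ y * H y" for y
        using h_le[OF T', of y] good_to_bad[OF T', of z y] z hA[of y T']
          transition_matrix_nonneg[OF transition[OF T'], of z y]
        by (cases "y \<in> good") (auto simp: H_def intro: mult_left_mono)
      then have "h T' z \<le> 1 + (\<Sum>y\<in>UNIV. T' $ z $ y * H y)"
        unfolding h_step[OF T' z] by (intro add_left_mono sum_mono)
      with opt[OF T', of z] show ?thesis by linarith
    qed
    with z show ?thesis
      using nonempty by (auto simp: H_def intro!: cSUP_least)
  qed
  \<comment> \<open>Subtracting the first-step equation of \<open>h T\<close> from the Bellman
    inequality cancels the constant 1 and makes \<open>w\<close> subharmonic.\<close>
  define w where "w z = (if z \<in> good then H z - h T z else 0)" for z
  have "w z \<le> 0" for z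
  proof (rule subharmonic_nonpos[where S = good and A = A and T = T])
    fix z assume z: "z \<in> good"
    have "(\<Sum>y\<in>UNIV. T $ z $ y * w y) = (\<Sum>y\<in>UNIV. T $ z $ y * H y - T $ z $ y * h T y)"
      using good_to_bad[OF T, of z] z hA[of _ T]
      by (intro sum.cong refl) (auto simp: w_def H_def right_diff_distrib)
    then show "w z \<le> (\<Sum>y\<in>UNIV. T $ z $ y * w y)"
      using H_le[OF z] h_step[OF T z] z by (simp add: w_def sum_subtractf)
  qed (use T in \<open>auto simp: transition w_def summable_survival\<close>)
  then have "H z \<le> h T z" if "z \<in> good" for z
    using that by (metis w_def diff_le_0_iff_le)
  with T h_le show ?thesis
    unfolding h_def by (meson order_trans)
qed

section \<open>The inverse matrix and the hitting times\<close>

text \<open>A kernel vector vanishing off \<open>good\<close> is harmonic on \<open>good\<close>, so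
  \<open>subharmonic_nonpos\<close> applies to it and to its negative.\<close>

lemma invertible_on_good:
  assumes T: "T \<in> \<T>"
  shows "invertible_on good (mat 1 - T)"
proof (rule invertible_onI)
  fix v :: "real ^ 'n"
  assume off: "\<And>z. z \<notin> good \<Longrightarrow> v $ z = 0"
    and ker: "\<And>z. z \<in> good \<Longrightarrow> ((mat 1 - T) *v v) $ z = 0"
  have fix_v: "(\<Sum>y\<in>UNIV. T $ z $ y * v $ y) = v $ z" if "z \<in> good" for z
    using ker[OF that]
    by (simp add: matrix_vector_mult_diff_rdistrib) (simp add: matrix_vector_mult_def)
  have "v $ z \<le> 0" for z
    using T off fix_v
    by (intro subharmonic_nonpos[where S = good and T = T and A = A and w = "\<lambda>z. v $ z"])
       (auto simp: transition summable_survival)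
  moreover have "- v $ z \<le> 0" for z
    using T off fix_v
    by (intro subharmonic_nonpos[where S = good and T = T and A = A and w = "\<lambda>z. - v $ z"])
       (auto simp: transition summable_survival sum_negf)
  ultimately show "v = 0"
    by (simp add: vec_eq_iff order_antisym)
qed

text \<open>Restricted to \<open>good\<close>, the first-step equations form the linear system with
  matrix \<open>mat 1 - T\<close>: target states contribute value 0 and bad states probability
  0.\<close>

lemma suminf_survival_eq_inverse:
  assumes T: "T \<in> \<T>" and z: "z \<in> good"
  shows "mult_vec_on good (matrix_inv_on good (mat 1 - T)) 1 $ z = (\<Sum>n. survival A T n z)"
proof (rule mult_vec_on_inverse[OF inverse_on_matrix_inv_on[OF invertible_on_good[OF T]] z])
  fix i assume i: "i \<in> good"
  let ?h = "\<lambda>j. \<Sum>n. survival A T n j"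
  have "?h i = 1 + (\<Sum>y\<in>UNIV. T $ i $ y * ?h y)"
    using T i by (rule suminf_survival_good)
  also have "(\<Sum>y\<in>UNIV. T $ i $ y * ?h y) = (\<Sum>y\<in>good. T $ i $ y * ?h y)"
    using i good_to_bad[OF T, of i] by (intro sum.mono_neutral_right) (auto simp: survival_target)
  finally have "?h i - (\<Sum>y\<in>good. T $ i $ y * ?h y) = 1" by simp
  moreover have "(\<Sum>j\<in>good. (mat 1 - T) $ i $ j * ?h j) =
      (\<Sum>j\<in>good. (if i = j then ?h j else 0) - T $ i $ j * ?h j)"
    by (intro sum.cong refl) (auto simp: mat_def left_diff_distrib)
  ultimately show "(\<Sum>j\<in>good. (mat 1 - T) $ i $ j * ?h j) = (1 :: real ^ 'n) $ i"
    using i by (simp add: sum_subtractf)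
qed

end

theorem theorem3:
  fixes \<T> :: "(real ^ 'n::finite ^ 'n) set" and A :: "'n set"
  assumes "CARD('n) \<ge> 2"
    and "\<T> \<noteq> {}"
    and "\<forall>T\<in>\<T>. transition_matrix T"
    and "compact \<T>"
    and "convex \<T>"
    and "separately_specified_rows \<T>"
    and "closed_states \<T> A"
  shows "(\<forall>z\<in>bad_states \<T> A. upper_expected_hitting_time \<T> A z = \<infinity>) \<and>
    (\<exists>T\<in>\<T>.
       invertible_on (- A - bad_states \<T> A) (mat 1 - T) \<and>
       (\<forall>z\<in>- A - bad_states \<T> A.
          enn2ereal (upper_expected_hitting_time \<T> A z) =
          ereal (mult_vec_on (- A - bad_states \<T> A)
                   (matrix_inv_on (- A - bad_states \<T> A) (mat 1 - T)) 1 $ z)))"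
proof -
  interpret closed_target \<T> A
    using assms by unfold_locales auto
  have "upper_expected_hitting_time \<T> A z = \<infinity>" if "z \<in> bad" for z
  proof -
    from bad_matrix obtain T where "T \<in> \<T>" "expected_hitting_time T A z = \<infinity>"
      using \<open>z \<in> bad\<close> by blast
    then have "\<infinity> \<le> upper_expected_hitting_time \<T> A z"
      unfolding upper_expected_hitting_time_def by (metis SUP_upper)
    then show ?thesis by (simp add: top_unique)
  qed
  moreover obtain T where T: "T \<in> \<T>" and
    opt: "\<And>z T'. z \<in> good \<Longrightarrow> T' \<in> \<T> \<Longrightarrow> (\<Sum>n. survival A T' n z) \<le> (\<Sum>n. survival A T n z)"
    using good_matrix by blast
  moreover have "enn2ereal (upper_expected_hitting_time \<T> A z) =
      ereal (mult_vec_on good (matrix_inv_on good (mat 1 - T)) 1 $ z)" if z: "z \<in> good" for z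
  proof -
    have eq: "expected_hitting_time T' A z = ennreal (\<Sum>n. survival A T' n z)" if "T' \<in> \<T>" for T'
      using that z by (intro expected_hitting_time_eq_suminf_real transition summable_survival) auto
    have "upper_expected_hitting_time \<T> A z = ennreal (\<Sum>n. survival A T n z)"
      unfolding upper_expected_hitting_time_def
      using T opt[OF z] by (intro antisym SUP_least SUP_upper2[OF T]) (auto simp: eq intro: ennreal_leI)
    \<comment> \<open>\<open>ennreal\<close> truncates negative reals, so the return to
      \<open>ereal\<close> needs a nonnegative sum.\<close>
    moreover have "0 \<le> (\<Sum>n. survival A T n z)"
      using T z by (intro suminf_nonneg summable_survival survival_nonneg transition) auto
    ultimately show ?thesis
      by (simp add: suminf_survival_eq_inverse[OF T z])
  qed
  ultimately show ?thesis
    using invertible_on_good by blast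
qed

end
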